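(* Let $\zeta_5$ be a primitive fifth root of unity. Then \[ \sum_{n=0}^\infty\sum_{m=-\infty}^\infty M2(m,n)\zeta_5^mq^n=\sum_{r=0}^4q^rM2_{r,5}(q^5), \] where \begin{align*} M2_{0,5}(q)&=\frac{(-q^3,-q^5,-q^7,q^{10};q^{10})_\infty}{(-q,q^4,q^6,-q^9;q^{10})_\infty},\qquad M2_{1,5}(q)=\frac{(-q^5,q^{10};q^{10})_\infty}{(q^2,q^8;q^{10})_\infty},\\ M2_{2,5}(q)&=(\zeta_5+\zeta_5^4)\frac{(q^2,-q^3,-q^5,-q^7,q^8,q^{10};q^{10})_\infty}{(-q,q^4,q^4,q^6,q^6,-q^9;q^{10})_\infty}-\frac{(-q,q^4,-q^5,q^6,-q^9,q^{10};q^{10})_\infty}{(q^2,q^2,-q^3,-q^7,q^8,q^8;q^{10})_\infty},\\ M2_{3,5}(q)&=(\zeta_5+\zeta_5^4)\frac{(-q^5,q^{10};q^{10})_\infty}{(q^4,q^6;q^{10})_\infty},\qquad M2_{4,5}(q)=-(\zeta_5+\zeta_5^4)\frac{(-q,-q^5,-q^9,q^{10};q^{10})_\infty}{(q^2,-q^3,-q^7,q^8;q^{10})_\infty}. \end{align*}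
   Context: $(a;q)_\infty=\prod_{k\ge0}(1-aq^k)$ and $(a_1,\dots,a_j;q)_\infty=(a_1;q)_\infty\cdots(a_j;q)_\infty$ (repeated arguments are repeated factors). The numbers $M2(m,n)$ are defined by \[ \sum_{n\ge0}\sum_mM2(m,n)z^mq^n=\frac{(-q;q^2)_\infty(q^2;q^2)_\infty}{(zq^2;q^2)_\infty(z^{-1}q^2;q^2)_\infty}. \] *)

theory Defs
  imports "HOL-Analysis.Analysis" "HOL-Computational_Algebra.Formal_Power_Series"
    "HOL-Computational_Algebra.Formal_Laurent_Series"
begin

text \<open>The infinite q-Pochhammer product (c q^j; q^k)_inf = prod_{i>=0} (1 - c q^(j+k i))
  as a formal power series in q with coefficients in a commutative ring.
  For j >= 1 and k >= 1 every factor with i > n is congruent to 1 modulo q^(n+1), so the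
  n-th coefficient of the infinite product is the n-th coefficient of the finite
  product over i <= n; this is the (coefficientwise stable) infinite product.\<close>
definition qpinf :: "'a::comm_ring_1 \<Rightarrow> nat \<Rightarrow> nat \<Rightarrow> 'a fps" where
  "qpinf c j k = Abs_fps (\<lambda>n. (\<Prod>i\<le>n. 1 - fps_const c * fps_X ^ (j + k * i)) $ n)"

text \<open>Generating function of M2(m,n): a power series in q whose coefficients are
  Laurent series (in fact Laurent polynomials) in z.  Here z = fls_X and z^-1 = fls_X_inv.\<close>
definition M2_gen :: "complex fls fps" where
  "M2_gen = (qpinf (-1) 1 2 * qpinf 1 2 2) / (qpinf fls_X 2 2 * qpinf fls_X_inv 2 2)"

definition M2 :: "int \<Rightarrow> nat \<Rightarrow> complex" where
  "M2 m n = fls_nth (M2_gen $ n) m"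

abbreviation P10 :: "complex \<Rightarrow> nat \<Rightarrow> complex fps" where
  "P10 c j \<equiv> qpinf c j 10"

definition M2_05_0 :: "complex fps" where
  "M2_05_0 = (P10 (-1) 3 * P10 (-1) 5 * P10 (-1) 7 * P10 1 10)
           / (P10 (-1) 1 * P10 1 4 * P10 1 6 * P10 (-1) 9)"

definition M2_05_1 :: "complex fps" where
  "M2_05_1 = (P10 (-1) 5 * P10 1 10) / (P10 1 2 * P10 1 8)"

definition M2_05_2 :: "complex \<Rightarrow> complex fps" where
  "M2_05_2 \<zeta> =
     fps_const (\<zeta> + \<zeta> ^ 4) *
       ((P10 1 2 * P10 (-1) 3 * P10 (-1) 5 * P10 (-1) 7 * P10 1 8 * P10 1 10)
        / (P10 (-1) 1 * P10 1 4 * P10 1 4 * P10 1 6 * P10 1 6 * P10 (-1) 9))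
     - (P10 (-1) 1 * P10 1 4 * P10 (-1) 5 * P10 1 6 * P10 (-1) 9 * P10 1 10)
        / (P10 1 2 * P10 1 2 * P10 (-1) 3 * P10 (-1) 7 * P10 1 8 * P10 1 8)"

definition M2_05_3 :: "complex \<Rightarrow> complex fps" where
  "M2_05_3 \<zeta> = fps_const (\<zeta> + \<zeta> ^ 4) * ((P10 (-1) 5 * P10 1 10) / (P10 1 4 * P10 1 6))"

definition M2_05_4 :: "complex \<Rightarrow> complex fps" where
  "M2_05_4 \<zeta> = - fps_const (\<zeta> + \<zeta> ^ 4) *
     ((P10 (-1) 1 * P10 (-1) 5 * P10 (-1) 9 * P10 1 10)
      / (P10 1 2 * P10 (-1) 3 * P10 (-1) 7 * P10 1 8))"

end

(* Put E(q) = (q;q)_inf and T_w(q) = (q, w q, q/w; q)_inf. Since the product of (w^r q; q)_inf over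
   all fifth roots of unity w^r is (q^5;q^5)_inf, and (-q;q^2)_inf (q^2;q^2)_inf = E(-q), the
   generating function at z = zeta equals E(-q) T_{zeta^2}(q^2) / E(q^10).
   By the Jacobi triple product and grouping the bilateral series by residues mod 5,
     T_w(q) = A + (w^2 + w^3) q B,  A = (q^10,q^15,q^25;q^25)_inf,  B = (q^5,q^20,q^25;q^25)_inf.
   Multiplying the cases w = zeta and w = zeta^2 gives
     E(q) E(q^5) = T_zeta T_{zeta^2} = A^2 - q A B - q^2 B^2,
   which dissects E(-q) after q -> -q; expanding the product of the two dissections
   gives the claimed terms one by one. *)
theory Submission
  imports Defs
begin

section \<open>Infinite products modulo powers of q\<close>

text \<open>No quotient is ever expanded. Both sides are multiplied by K = E(q^10) E(-q^5), which
  contains every denominator of the claim, so that the six quotients in it become monomial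
  identities between the products (q^j;q^50)_inf and (-q^j;q^50)_inf. The factor E(-q^5) is forced:
  the conjugate pair of triple products yields E(q) E(q^5), not E(q) alone. Only two of the five
  residue classes survive in the dissection of T_w because the exponents are triangular numbers: n
  -> -1-n pairs residue r with 4-r and reverses the sign, which kills residue 2. Setting z to a root
  of unity makes no sense for general Laurent series. It is legitimate here because each coefficient
  of the generating function is a Laurent polynomial in z, a fact that has to survive the inversion
  of the denominator.\<close>

definition fps_agree :: "nat \<Rightarrow> 'a::comm_ring_1 fps \<Rightarrow> 'a fps \<Rightarrow> bool" where
  "fps_agree N f g \<longleftrightarrow> (\<forall>n\<le>N. f $ n = g $ n)"

lemma fps_agree_refl [simp]: "fps_agree N f f"
  by (simp add: fps_agree_def)

lemma fps_agree_sym: "fps_agree N f g \<Longrightarrow> fps_agree N g f"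
  by (simp add: fps_agree_def)

lemma fps_agree_trans [trans]: "fps_agree N f g \<Longrightarrow> fps_agree N g h \<Longrightarrow> fps_agree N f h"
  by (simp add: fps_agree_def)

lemma fps_agree_mult:
  "fps_agree N f f' \<Longrightarrow> fps_agree N g g' \<Longrightarrow> fps_agree N (f * g) (f' * g')"
  by (auto simp: fps_agree_def fps_mult_nth intro!: sum.cong)

lemma fps_agree_prod:
  "(\<And>i. i \<in> A \<Longrightarrow> fps_agree N (f i) (g i)) \<Longrightarrow> fps_agree N (\<Prod>i\<in>A. f i) (\<Prod>i\<in>A. g i)"
  by (induction A rule: infinite_finite_induct) (auto intro: fps_agree_mult)

lemma fps_agree_sum:
  "(\<And>i. i \<in> A \<Longrightarrow> fps_agree N (f i) (g i)) \<Longrightarrow> fps_agree N (\<Sum>i\<in>A. f i) (\<Sum>i\<in>A. g i)"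
  by (auto simp: fps_agree_def fps_sum_nth intro!: sum.cong)

lemma fps_agree_compose:
  "fps_agree N f g \<Longrightarrow> fps_agree N (f oo h) (g oo h)"
  by (auto simp: fps_agree_def fps_compose_nth intro!: sum.cong)

lemma fps_eqI_agree: "(\<And>N. fps_agree N f g) \<Longrightarrow> f = g"
  by (auto simp: fps_agree_def fps_eq_iff)

lemma fps_agree_cancel:
  fixes f g h :: "'a::field fps"
  assumes "fps_agree N (f * h) (g * h)" "h $ 0 \<noteq> 0"
  shows "fps_agree N f g"
proof -
  have "fps_agree N (f * h * inverse h) (g * h * inverse h)"
    using assms(1) by (rule fps_agree_mult) simp
  moreover have "h * inverse h = 1"
    using assms(2) by (rule inverse_mult_eq_1')
  ultimately show ?thesis
    by (simp only: mult.assoc mult_1_right)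
qed

section \<open>Truncated products, splitting by residues and substitutions for q\<close>

definition qpfin :: "'a::comm_ring_1 \<Rightarrow> nat \<Rightarrow> nat \<Rightarrow> nat \<Rightarrow> 'a fps" where
  "qpfin c j k M = (\<Prod>i<M. 1 - fps_const c * fps_X ^ (j + k * i))"

lemma qpfin_agree:
  assumes "k > 0" "N < M"
  shows "fps_agree N (qpfin c j k (Suc M)) (qpfin c j k M)"
proof -
  have "M \<le> j + k * M" using assms(1) by (cases k) auto
  with assms have "fps_agree N (1 - fps_const c * fps_X ^ (j + k * M)) 1"
    by (auto simp: fps_agree_def fps_X_power_iff)
  from fps_agree_mult[OF fps_agree_refl this, of "qpfin c j k M"]
  show ?thesis by (simp add: qpfin_def)
qed

text \<open>Every identity of infinite products below is proved through this bridge: modulo q^(N+1)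
  both sides become finite products, where factors may be reordered and regrouped freely.\<close>

lemma qpinf_agree:
  assumes "k > 0" "N < M"
  shows "fps_agree N (qpinf c j k) (qpfin c j k M)"
  unfolding fps_agree_def
proof (intro allI impI)
  fix n assume "n \<le> N"
  with assms have "Suc n \<le> M" by simp
  then have "qpfin c j k M $ n = qpfin c j k (Suc n) $ n"
  proof (induction M rule: dec_induct)
    case (step m)
    with qpfin_agree[OF assms(1), of n m c j] show ?case
      by (simp add: fps_agree_def)
  qed simp
  then show "qpinf c j k $ n = qpfin c j k M $ n"
    by (simp add: qpinf_def qpfin_def lessThan_Suc_atMost)
qed

lemma qpinf_nth_0: "j > 0 \<Longrightarrow> qpinf c j k $ 0 = 1"
  by (simp add: qpinf_def fps_X_power_iff)

lemma qpinf_split_first: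
  assumes "k > 0"
  shows "qpinf c j k = (1 - fps_const c * fps_X ^ j) * qpinf c (j + k) k"
proof (rule fps_eqI_agree)
  fix N
  have "fps_agree N (qpinf c j k) (qpfin c j k (Suc (Suc N)))"
    using assms by (intro qpinf_agree) auto
  also have "qpfin c j k (Suc (Suc N)) = (1 - fps_const c * fps_X ^ j) * qpfin c (j + k) k (Suc N)"
    unfolding qpfin_def by (subst prod.lessThan_Suc_shift) (simp add: algebra_simps)
  also have "fps_agree N \<dots> ((1 - fps_const c * fps_X ^ j) * qpinf c (j + k) k)"
    using assms by (intro fps_agree_mult fps_agree_sym[OF qpinf_agree]) auto
  finally show "fps_agree N (qpinf c j k) ((1 - fps_const c * fps_X ^ j) * qpinf c (j + k) k)" .
qed

lemma qpinf_split_mod: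
  assumes "k > 0" "m > 0"
  shows "qpinf c j k = (\<Prod>r<m. qpinf c (j + k * r) (k * m))"
proof (rule fps_eqI_agree)
  fix N
  \<comment> \<open>The truncation length is a multiple of m, so that it splits into complete
    residue blocks.\<close>
  have "Suc N \<le> Suc N * m" using assms by (cases m) auto
  then have "fps_agree N (qpinf c j k) (qpfin c j k (Suc N * m))"
    using assms by (intro qpinf_agree) auto
  also have "qpfin c j k (Suc N * m) = (\<Prod>i<Suc N. \<Prod>r<m. 1 - fps_const c * fps_X ^ (j + k * (r + i * m)))"
    unfolding qpfin_def prod.nat_group[symmetric]
    using prod.shift_bounds_nat_ivl[of _ 0 _ m]
    by (intro prod.cong[OF refl, of "{..<Suc N}"]) (simp add: atLeast0LessThan add.commute[of m])
  also have "\<dots> = (\<Prod>r<m. \<Prod>i<Suc N. 1 - fps_const c * fps_X ^ (j + k * (r + i * m)))"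
    by (rule prod.swap)
  also have "\<dots> = (\<Prod>r<m. qpfin c (j + k * r) (k * m) (Suc N))"
    by (simp add: qpfin_def algebra_simps)
  also have "fps_agree N \<dots> (\<Prod>r<m. qpinf c (j + k * r) (k * m))"
    using assms by (intro fps_agree_prod fps_agree_sym[OF qpinf_agree]) auto
  finally show "fps_agree N (qpinf c j k) (\<Prod>r<m. qpinf c (j + k * r) (k * m))" .
qed

text \<open>Since s^k = 1, the power s^(j + k*i) equals s^j for every i, so all factors keep a
  common constant. This covers q -> q^m (with s = 1) and q -> -q (with s = -1 and k even).\<close>

lemma qpinf_compose:
  fixes c s :: "'a::idom"
  assumes "k > 0" "m > 0" "s ^ k = 1"
  shows "qpinf c j k oo (fps_const s * fps_X ^ m) = qpinf (c * s ^ j) (m * j) (m * k)"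
proof (rule fps_eqI_agree)
  fix N
  let ?h = "fps_const s * fps_X ^ m"
  have h0: "?h $ 0 = 0" using assms by simp
  have "fps_agree N (qpinf c j k oo ?h) (qpfin c j k (Suc N) oo ?h)"
    using assms by (intro fps_agree_compose qpinf_agree) auto
  also have "qpfin c j k (Suc N) oo ?h = (\<Prod>i<Suc N. 1 - fps_const c * ?h ^ (j + k * i))"
    by (simp add: qpfin_def fps_compose_prod_distrib[OF h0] fps_compose_sub_distrib
        fps_compose_mult_distrib[OF h0] fps_X_power_compose[OF h0])
  also have "\<dots> = qpfin (c * s ^ j) (m * j) (m * k) (Suc N)"
    unfolding qpfin_def
  proof (intro prod.cong refl)
    fix i
    have "?h ^ (j + k * i) = fps_const (s ^ j) * fps_X ^ (m * j + m * k * i)"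
      using assms(3)
      by (simp add: power_mult_distrib power_add power_mult fps_const_power mult.assoc)
    then show "1 - fps_const c * ?h ^ (j + k * i)
        = 1 - fps_const (c * s ^ j) * fps_X ^ (m * j + m * k * i)"
      by (simp add: mult.assoc flip: fps_const_mult)
  qed
  also have "fps_agree N \<dots> (qpinf (c * s ^ j) (m * j) (m * k))"
    using assms by (intro fps_agree_sym[OF qpinf_agree]) auto
  finally show "fps_agree N (qpinf c j k oo ?h) (qpinf (c * s ^ j) (m * j) (m * k))" .
qed

section \<open>The Jacobi triple product\<close>

text \<open>The q-Pascal rule serves as the definition because it makes sense in any commutative
  ring; the quotient of q-factorials is recovered in multiplied-out form by
  \<open>gauss_binomial_qfact\<close>.\<close>

fun gauss_binomial :: "'a::comm_ring_1 \<Rightarrow> nat \<Rightarrow> nat \<Rightarrow> 'a" where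
  "gauss_binomial q n 0 = 1"
| "gauss_binomial q 0 (Suc m) = 0"
| "gauss_binomial q (Suc n) (Suc m) = q ^ Suc m * gauss_binomial q n (Suc m) + gauss_binomial q n m"

lemma gauss_binomial_eq_0: "n < m \<Longrightarrow> gauss_binomial q n m = 0"
  by (induction q n m rule: gauss_binomial.induct) auto

lemma gauss_binomial_self: "gauss_binomial q n n = 1"
  by (induction n) (auto simp: gauss_binomial_eq_0)

text \<open>Induction on a + b through the q-Pascal rule; the two resulting terms combine by q^a (1
  - q^b) + (1 - q^a) = 1 - q^(a+b).\<close>

lemma gauss_binomial_qfact:
  "gauss_binomial q (a + b) a * (\<Prod>i<a. 1 - q ^ Suc i) * (\<Prod>i<b. 1 - q ^ Suc i) = (\<Prod>i<a+b. 1 - q ^ Suc i)"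
proof (induction "a + b" arbitrary: a b)
  case (Suc n)
  show ?case
  proof (cases "a = 0 \<or> b = 0")
    case True
    then show ?thesis by (auto simp: gauss_binomial_self)
  next
    case False
    then obtain a' b' where ab: "a = Suc a'" "b = Suc b'"
      by (metis not0_implies_Suc)
    let ?P = "\<lambda>n. \<Prod>i<n. 1 - q ^ Suc i"
    have 1: "gauss_binomial q (Suc a' + b') (Suc a') * ?P (Suc a') * ?P b' = ?P (Suc a' + b')"
      using Suc(1)[of "Suc a'" b'] Suc(2) ab by simp
    have 2: "gauss_binomial q (a' + Suc b') a' * ?P a' * ?P (Suc b') = ?P (a' + Suc b')"
      using Suc(1)[of a' "Suc b'"] Suc(2) ab by simp
    have "gauss_binomial q (a + b) a * ?P a * ?P b =
        q ^ Suc a' * (1 - q ^ Suc b') * (gauss_binomial q (Suc a' + b') (Suc a') * ?P (Suc a') * ?P b')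
      + (1 - q ^ Suc a') * (gauss_binomial q (a' + Suc b') a' * ?P a' * ?P (Suc b'))"
      by (simp add: ab algebra_simps)
    also have "\<dots> = (1 - q ^ Suc (Suc a' + b')) * ?P (Suc a' + b')"
      unfolding 1 2 by (simp add: algebra_simps power_add)
    finally show ?thesis by (simp add: ab mult.commute)
  qed
qed simp

text \<open>Splitting off the factor i = 0 turns x into x*q in the rest, hence the induction with x
  arbitrary. The second variable y keeps the formula homogeneous: a negative power of q in x/y can
  then be realised by taking y to be a positive power, without inverses.\<close>

lemma q_binomial_theorem:
  fixes x y q :: "'a::comm_ring_1"
  shows "(\<Prod>i<n. y - x * q ^ i)
    = (\<Sum>m\<le>n. (-1) ^ m * q ^ (m choose 2) * gauss_binomial q n m * x ^ m * y ^ (n - m))"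
proof (induction n arbitrary: x)
  case (Suc n)
  let ?t = "\<lambda>m. (-1) ^ m * q ^ (m choose 2) * gauss_binomial q n m * (x * q) ^ m"
  have "(\<Prod>i<Suc n. y - x * q ^ i) = (y - x) * (\<Prod>i<n. y - (x * q) * q ^ i)"
    by (subst prod.lessThan_Suc_shift) (simp add: mult.assoc)
  also have "\<dots> = (\<Sum>m\<le>n. ?t m * y ^ (Suc n - m)) - (\<Sum>m\<le>n. x * ?t m * y ^ (n - m))"
    unfolding Suc sum_distrib_left sum_subtractf[symmetric]
    by (intro sum.cong refl) (simp add: Suc_diff_le algebra_simps)
  also have "(\<Sum>m\<le>n. ?t m * y ^ (Suc n - m)) = (\<Sum>m\<le>Suc n. ?t m * y ^ (Suc n - m))"
    by (simp add: gauss_binomial_eq_0)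
  also have "\<dots> = y ^ Suc n + (\<Sum>m\<le>n. ?t (Suc m) * y ^ (n - m))"
    by (subst sum.atMost_Suc_shift) (simp add: numeral_2_eq_2)
  \<comment> \<open>Both sums contain q^(Suc m choose 2) x^(Suc m), because (Suc m choose 2) = (m
    choose 2) + m; what is left in the bracket is the q-Pascal rule.\<close>
  also have "y ^ Suc n + (\<Sum>m\<le>n. ?t (Suc m) * y ^ (n - m)) - (\<Sum>m\<le>n. x * ?t m * y ^ (n - m))
     = y ^ Suc n + (\<Sum>m\<le>n. (-1) ^ Suc m * q ^ (Suc m choose 2) * gauss_binomial q (Suc n) (Suc m) * x ^ Suc m * y ^ (n - m))"
    unfolding diff_conv_add_uminus add.assoc sum_negf[symmetric] sum.distrib[symmetric]
    by (intro arg_cong2[where f = "(+)"] refl sum.cong)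
       (simp add: algebra_simps power_mult_distrib power_add numeral_2_eq_2)
  also have "\<dots> = (\<Sum>m\<le>Suc n. (-1) ^ m * q ^ (m choose 2) * gauss_binomial q (Suc n) m * x ^ m * y ^ (Suc n - m))"
    by (subst sum.atMost_Suc_shift) (simp add: numeral_2_eq_2)
  finally show ?case .
qed (simp add: numeral_2_eq_2)

section \<open>Exponents and coefficients of the bilateral series\<close>

text \<open>The exponents in the triple product series. They are nonnegative for \<open>0 < j \<le> k\<close>, so that
  no information is lost in the conversion to a natural number.\<close>
definition jexp :: "nat \<Rightarrow> nat \<Rightarrow> int \<Rightarrow> nat" where
  "jexp j k n = nat (int k * (n * (n - 1) div 2) + int j * n)"

text \<open>The bilateral series over all integers n of (-c)^n X^(\<open>jexp j k n\<close>), given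
  by its coefficients. For 0 < j \<le> k each of these is a finite sum, by
  \<open>finite_jexp_eq\<close>.\<close>

definition theta :: "'a::field \<Rightarrow> nat \<Rightarrow> nat \<Rightarrow> 'a fps" where
  "theta c j k = Abs_fps (\<lambda>d. \<Sum>n | jexp j k n = d. (-c) powi n)"

lemma two_times_triangle: "2 * (n * (n - 1) div 2) = n * (n - 1)" for n :: int
  by (rule dvd_mult_div_cancel) (cases "even n", auto)

text \<open>A linear bound is enough for finite fibres and for truncation. For n \<le> 0, replacing
  j by k gives the lower bound k*n*(n+1)/2, and (n+1)*(n+2) \<ge> 0 makes this at least -n-1. The
  summand 1 is attained at j = k, n = -1, where the exponent is 0.\<close>

lemma jexp_bound:
  assumes "0 < j" "j \<le> k"
  shows "\<bar>n\<bar> \<le> int k * (n * (n - 1) div 2) + int j * n + 1"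
proof -
  define t where "t = n * (n - 1) div 2"
  have t: "2 * t = n * (n - 1)"
    unfolding t_def by (rule two_times_triangle)
  show ?thesis
  proof (cases "n > 0")
    case True
    then have "0 \<le> n * (n - 1)" by simp
    with t have "0 \<le> int k * t" by (intro mult_nonneg_nonneg) linarith+
    moreover have "1 * n \<le> int j * n"
      using assms True by (intro mult_right_mono) auto
    ultimately have "n \<le> int k * t + int j * n + 1" by linarith
    with True show ?thesis by (simp add: t_def)
  next
    case False
    then have "0 \<le> n * (n + 1)"
      by (cases "n = 0") (auto intro: mult_nonpos_nonpos)
    with t have tn: "0 \<le> t + n" by (simp add: algebra_simps)
    have "0 \<le> (n + 1) * (n + 2)"
      by (cases "n = -1"; cases "n \<le> -2") (use False in \<open>auto simp: mult_nonpos_nonpos\<close>)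
    with t have "-n - 1 \<le> t + n" by (simp add: algebra_simps)
    also have "1 * (t + n) \<le> int k * (t + n)"
      using assms tn by (intro mult_right_mono) auto
    also have "\<dots> = int k * t + int k * n" by (simp add: algebra_simps)
    also have "int k * n \<le> int j * n"
      using assms False by (intro mult_right_mono_neg) auto
    finally have "-n \<le> int k * t + int j * n + 1" by simp
    with False show ?thesis by (simp add: t_def)
  qed
qed

lemma int_jexp:
  assumes "0 < j" "j \<le> k"
  shows "int (jexp j k n) = int k * (n * (n - 1) div 2) + int j * n"
proof (cases "n = 0")
  case False
  with jexp_bound[OF assms, of n] show ?thesis by (simp add: jexp_def)
qed (simp add: jexp_def)

lemma two_int_jexp:
  assumes "0 < j" "j \<le> k"
  shows "2 * int (jexp j k n) = int k * (n * (n - 1)) + 2 * int j * n"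
  using two_times_triangle[of n] by (simp add: int_jexp[OF assms] algebra_simps)

lemma abs_le_jexp:
  assumes "0 < j" "j \<le> k"
  shows "\<bar>n\<bar> \<le> int (jexp j k n) + 1"
  using jexp_bound[OF assms] by (simp add: int_jexp[OF assms])

lemma finite_jexp_eq:
  assumes "0 < j" "j \<le> k"
  shows "finite {n. jexp j k n = d}"
proof (rule finite_subset)
  show "{n. jexp j k n = d} \<subseteq> {- int d - 1..int d + 1}"
    using abs_le_jexp[OF assms] by (auto simp: abs_le_iff) (smt (verit))+
qed simp

text \<open>Centring at the middle term: relative to m = M, the term m = M + n of the q-binomial
  expansion carries exactly the exponent \<open>jexp j k n\<close>. Everything is doubled to avoid
  the halves in the triangular numbers.\<close>

lemma jexp_shift:
  assumes "0 < j" "j \<le> k" "0 < M" "m \<le> 2 * M"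
  shows "k * (m choose 2) + (k * M - j) * (2 * M - m)
    = k * (M choose 2) + (k * M - j) * M + jexp j k (int m - int M)"
proof -
  define A where "A = int (m choose 2)"
  define B where "B = int (M choose 2)"
  define J where "J = int (jexp j k (int m - int M))"
  have ch: "2 * int (i choose 2) = int i * (int i - 1)" for i
  proof -
    have "2 * (i choose 2) = i * (i - 1)"
      unfolding choose_two by (rule dvd_mult_div_cancel) (cases "even i", auto)
    then have "int (2 * (i choose 2)) = int (i * (i - 1))" by simp
    then show ?thesis by (cases i) (simp_all add: algebra_simps)
  qed
  have "j \<le> k * M" using assms by (cases M) auto
  then have kMj: "int (k * M - j) = int k * int M - int j" by (simp add: of_nat_diff)
  have "2 * (int k * A) = int k * (int m * (int m - 1))" "2 * (int k * B) = int k * (int M * (int M - 1))"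
    using ch[of m] ch[of M] by (simp_all add: A_def B_def)
  moreover have "2 * J = int k * ((int m - int M) * (int m - int M - 1)) + 2 * int j * (int m - int M)"
    unfolding J_def by (rule two_int_jexp[OF assms(1,2)])
  ultimately have "int k * A + (int k * int M - int j) * (2 * int M - int m)
    = int k * B + (int k * int M - int j) * int M + J"
    by (simp add: algebra_simps)
  then have "int (k * (m choose 2) + (k * M - j) * (2 * M - m))
    = int (k * (M choose 2) + (k * M - j) * M + jexp j k (int m - int M))"
    using assms(4) by (simp add: A_def B_def J_def kMj of_nat_diff)
  then show ?thesis by linarith
qed

text \<open>This is the q-binomial theorem for \<open>\<Prod>i<2M. (y - c q\<^sup>i)\<close> with base \<open>X\<^sup>k\<close> and
  \<open>y = X\<^bsup>kM-j\<^esup>\<close>: the factors with \<open>i < M\<close> yield the product in \<open>inverse c\<close>, up to the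
  monomial \<open>u\<close>.\<close>
lemma finite_triple_product:
  fixes c :: "'a::field"
  assumes jk: "0 < j" "j \<le> k" and c: "c \<noteq> 0"
  shows "qpfin c j k M * qpfin (inverse c) (k - j) k M
    = (\<Sum>n = - int M..int M. fps_const ((-c) powi n) * fps_X ^ jexp j k n
         * gauss_binomial (fps_X ^ k) (2 * M) (nat (int M + n)))"
proof (cases "M = 0")
  case True
  then show ?thesis by (simp add: qpfin_def jexp_def)
next
  case False
  then have M: "0 < M" and jkM: "j \<le> k * M" using jk by (cases M; simp)+
  define y :: "'a fps" where "y = fps_X ^ (k * M - j)"
  define x where "x = fps_const c"
  define q :: "'a fps" where "q = fps_X ^ k"
  \<comment> \<open>This is the monomial of the middle term m = M, and also what the two halves of
    the product give off: y^M from the upper one, (-c)^M q^(M choose 2) from the lower one.\<close>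
  define u where "u = fps_const ((-c) ^ M) * fps_X ^ (k * (M choose 2) + (k * M - j) * M)"
  have uX: "fps_X ^ (k * (M choose 2) + (k * M - j) * M) = q ^ (M choose 2) * y ^ M"
    by (simp add: q_def y_def power_add flip: power_mult)
  have "u \<noteq> 0" using c by (simp add: u_def)
  have 1: "(\<Prod>i<M. y - x * q ^ (i + M)) = y ^ M * qpfin c j k M"
  proof -
    have "y - x * q ^ (i + M) = y * (1 - fps_const c * fps_X ^ (j + k * i))" for i
    proof -
      have "k * (i + M) = (k * M - j) + (j + k * i)" using jkM by (simp add: algebra_simps)
      then have "q ^ (i + M) = y * fps_X ^ (j + k * i)"
        by (simp add: q_def y_def flip: power_mult power_add)
      then show ?thesis by (simp add: x_def algebra_simps)
    qed
    then show ?thesis by (simp add: qpfin_def prod.distrib)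
  qed
  have 2: "(\<Prod>i<M. y - x * q ^ i) =
      fps_const ((-c) ^ M) * q ^ (M choose 2) * qpfin (inverse c) (k - j) k M"
  proof -
    \<comment> \<open>Reversing the order gives factor i the required exponent, since k*M - j = k*(M
      - Suc i) + (k - j + k*i).\<close>
    have "(\<Prod>i<M. y - x * q ^ i) = (\<Prod>i<M. y - x * q ^ (M - Suc i))"
      by (rule prod.nat_diff_reindex[symmetric])
    also have "\<dots> = (\<Prod>i<M. fps_const (-c) * q ^ (M - Suc i) * (1 - fps_const (inverse c) * fps_X ^ (k - j + k * i)))"
    proof (intro prod.cong refl)
      fix i assume "i \<in> {..<M}"
      then obtain d where d: "M = Suc i + d" by (auto dest: less_imp_Suc_add)
      have "k * M - j = k * (M - Suc i) + (k - j + k * i)"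
        using jk by (simp add: d algebra_simps)
      then have y: "y = q ^ (M - Suc i) * fps_X ^ (k - j + k * i)"
        by (simp add: y_def q_def flip: power_mult power_add)
      have "fps_const (-c) * fps_const (inverse c) = -1"
        using c by (simp flip: fps_const_neg)
      then have "fps_const (-c) * q ^ (M - Suc i) * (fps_const (inverse c) * fps_X ^ (k - j + k * i)) = - y"
        unfolding y by (metis (no_types, lifting) mult.assoc mult.commute mult_minus1)
      then show "y - x * q ^ (M - Suc i) = fps_const (-c) * q ^ (M - Suc i)
          * (1 - fps_const (inverse c) * fps_X ^ (k - j + k * i))"
        by (simp add: right_diff_distrib x_def flip: fps_const_neg)
    qed
    also have "\<dots> = fps_const ((-c) ^ M) * (\<Prod>i<M. q ^ (M - Suc i)) * qpfin (inverse c) (k - j) k M"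
      by (simp add: prod.distrib qpfin_def fps_const_power)
    also have "(\<Prod>i<M. q ^ (M - Suc i)) = (\<Prod>i<M. q ^ i)"
      by (rule prod.nat_diff_reindex)
    also have "\<dots> = q ^ (\<Sum>i<M. i)" by (rule power_sum[symmetric])
    also have "(\<Sum>i<M. i) = M choose 2"
      by (induction M) (auto simp: numeral_2_eq_2)
    finally show ?thesis .
  qed
  have "u * (qpfin c j k M * qpfin (inverse c) (k - j) k M)
    = (\<Prod>i<M. y - x * q ^ i) * (\<Prod>i<M. y - x * q ^ (i + M))"
    unfolding 1 2 u_def uX by (simp only: mult_ac)
  also have "\<dots> = (\<Prod>i<2 * M. y - x * q ^ i)"
  proof -
    have "(\<Prod>i<2 * M. y - x * q ^ i) = (\<Prod>i=0..<M. y - x * q ^ i) * (\<Prod>i=M..<M+M. y - x * q ^ i)"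
      unfolding mult_2 atLeast0LessThan[symmetric]
      by (rule prod.atLeastLessThan_concat[symmetric]) auto
    also have "(\<Prod>i=M..<M+M. y - x * q ^ i) = (\<Prod>i<M. y - x * q ^ (i + M))"
      using prod.shift_bounds_nat_ivl[of "\<lambda>i. y - x * q ^ i" 0 M M] by (simp add: atLeast0LessThan)
    finally show ?thesis by (simp add: atLeast0LessThan)
  qed
  also have "\<dots> = (\<Sum>m\<le>2 * M. (-1) ^ m * q ^ (m choose 2) * gauss_binomial q (2 * M) m * x ^ m * y ^ (2 * M - m))"
    by (rule q_binomial_theorem)
  also have "\<dots> = (\<Sum>m\<le>2 * M. u * (fps_const ((-c) powi (int m - int M)) * fps_X ^ jexp j k (int m - int M) * gauss_binomial q (2 * M) m))"
  proof (intro sum.cong refl)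
    fix m assume m: "m \<in> {..2 * M}"
    have a: "q ^ (m choose 2) * y ^ (2 * M - m)
        = fps_X ^ (k * (M choose 2) + (k * M - j) * M) * fps_X ^ jexp j k (int m - int M)"
      using jexp_shift[OF jk M, of m] m
      by (simp add: q_def y_def flip: power_mult power_add)
    have "(-c) ^ m = (-c) ^ M * (-c) powi (int m - int M)"
      using c by (simp add: power_int_diff)
    moreover have "(-1) ^ m * x ^ m = fps_const ((-c) ^ m)"
      by (simp add: x_def power_mult_distrib[symmetric] flip: fps_const_power)
    ultimately have b: "(-1) ^ m * x ^ m = fps_const ((-c) ^ M) * fps_const ((-c) powi (int m - int M))"
      by simp
    have "(-1) ^ m * q ^ (m choose 2) * gauss_binomial q (2 * M) m * x ^ m * y ^ (2 * M - m)
      = ((-1) ^ m * x ^ m) * (q ^ (m choose 2) * y ^ (2 * M - m)) * gauss_binomial q (2 * M) m"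
      by (simp only: mult_ac)
    also have "\<dots> = u * (fps_const ((-c) powi (int m - int M)) * fps_X ^ jexp j k (int m - int M) * gauss_binomial q (2 * M) m)"
      unfolding a b u_def by (simp only: mult_ac)
    finally show "(-1) ^ m * q ^ (m choose 2) * gauss_binomial q (2 * M) m * x ^ m * y ^ (2 * M - m)
      = u * (fps_const ((-c) powi (int m - int M)) * fps_X ^ jexp j k (int m - int M) * gauss_binomial q (2 * M) m)" .
  qed
  also have "\<dots> = u * (\<Sum>m\<le>2 * M. fps_const ((-c) powi (int m - int M)) * fps_X ^ jexp j k (int m - int M) * gauss_binomial q (2 * M) m)"
    by (rule sum_distrib_left[symmetric])
  also have "(\<Sum>m\<le>2 * M. fps_const ((-c) powi (int m - int M)) * fps_X ^ jexp j k (int m - int M) * gauss_binomial q (2 * M) m)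
    = (\<Sum>n = - int M..int M. fps_const ((-c) powi n) * fps_X ^ jexp j k n * gauss_binomial q (2 * M) (nat (int M + n)))"
    by (rule sum.reindex_bij_witness[of _ "\<lambda>n. nat (int M + n)" "\<lambda>m. int m - int M"]) auto
  finally show ?thesis
    using \<open>u \<noteq> 0\<close> by (simp add: q_def)
qed

text \<open>The limit of the Gaussian binomial is 1/E with E = \<open>qpinf 1 k k\<close>. In the
  multiplied-out quotient formula the truncations of lengths a, b and a + b all agree with E up to
  degree N; one of the two copies of E on the left then cancels.\<close>

lemma gauss_binomial_X_agree:
  assumes "0 < k" "N < a" "N < b"
  shows "fps_agree N (gauss_binomial (fps_X ^ k) (a + b) a * qpinf 1 k k) (1 :: 'a::field fps)"
proof -
  let ?E = "qpinf 1 k k :: 'a fps"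
  let ?g = "gauss_binomial (fps_X ^ k) (a + b) a :: 'a fps"
  have P: "(\<Prod>i<n. 1 - (fps_X ^ k) ^ Suc i) = (qpfin 1 k k n :: 'a fps)" for n
    by (simp add: qpfin_def power_add power_mult)
  have "fps_agree N (?g * ?E * ?E) (?g * qpfin 1 k k a * qpfin 1 k k b)"
    using assms by (intro fps_agree_mult[OF fps_agree_mult] fps_agree_refl qpinf_agree)
  also have "?g * qpfin 1 k k a * qpfin 1 k k b = qpfin 1 k k (a + b)"
    using gauss_binomial_qfact[of "fps_X ^ k :: 'a fps" a b] unfolding P .
  also have "fps_agree N (qpfin 1 k k (a + b)) (1 * ?E)"
    using assms by (auto intro: fps_agree_sym[OF qpinf_agree])
  finally show ?thesis
    by (rule fps_agree_cancel) (use assms in \<open>simp add: qpinf_nth_0\<close>)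
qed

text \<open>The limit of \<open>finite_triple_product\<close> as M grows. The case j = k is
  included: there the last product starts at exponent 0 and carries the factor 1 -
  \<open>inverse c\<close>.\<close>

lemma triple_product:
  fixes c :: "'a::field"
  assumes jk: "0 < j" "j \<le> k" and c: "c \<noteq> 0"
  shows "qpinf 1 k k * qpinf c j k * qpinf (inverse c) (k - j) k = theta c j k"
proof (rule fps_eqI_agree)
  fix N
  \<comment> \<open>An exponent at most N forces \<bar>n\<bar> \<le> N + 1 by
    \<open>abs_le_jexp\<close>, so M + n and M - n both exceed N, as
    \<open>gauss_binomial_X_agree\<close> demands.\<close>
  define M :: nat where "M = 2 * N + 2"
  let ?E = "qpinf 1 k k :: 'a fps"
  let ?g = "\<lambda>n. gauss_binomial (fps_X ^ k :: 'a fps) (2 * M :: nat) (nat (int M + n))"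
  let ?t = "\<lambda>n. fps_const ((-c) powi n) * fps_X ^ jexp j k n :: 'a fps"
  have k: "0 < k" using jk by simp
  have "fps_agree N (?E * qpinf c j k * qpinf (inverse c) (k - j) k)
      (?E * qpfin c j k M * qpfin (inverse c) (k - j) k M)"
    using k by (intro fps_agree_mult[OF fps_agree_mult] fps_agree_refl qpinf_agree)
      (auto simp: M_def)
  also have "?E * qpfin c j k M * qpfin (inverse c) (k - j) k M
      = (\<Sum>n = - int M..int M. ?t n * (?g n * ?E))"
    unfolding mult.assoc finite_triple_product[OF jk c, unfolded mult.assoc]
    by (simp add: sum_distrib_left mult_ac)
  also have "fps_agree N \<dots> (\<Sum>n = - int M..int M. ?t n)"
  proof (rule fps_agree_sum)
    fix n assume n: "n \<in> {- int M..int M}"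
    show "fps_agree N (?t n * (?g n * ?E)) (?t n)"
    proof (cases "jexp j k n \<le> N")
      case True
      with abs_le_jexp[OF jk, of n] have "\<bar>n\<bar> \<le> int N + 1" by linarith
      then have "N < nat (int M + n)" "N < nat (int M - n)"
        by (auto simp: M_def)
      moreover have "nat (int M + n) + nat (int M - n) = 2 * M"
        using n by auto
      ultimately have "fps_agree N (?g n * ?E) 1"
        using gauss_binomial_X_agree[OF k, of N "nat (int M + n)" "nat (int M - n)"] by simp
      from fps_agree_mult[OF fps_agree_refl this, of "?t n"] show ?thesis by simp
    next
      case False
      then have "fps_agree N (?t n) 0"
        by (auto simp: fps_agree_def fps_X_power_iff)
      from this fps_agree_mult[OF this fps_agree_refl, of "?g n * ?E"] show ?thesis
        by (auto intro: fps_agree_trans fps_agree_sym)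
    qed
  qed
  also have "fps_agree N \<dots> (theta c j k)"
    unfolding fps_agree_def
  proof (intro allI impI)
    fix d assume "d \<le> N"
    then have sub: "{n. jexp j k n = d} \<subseteq> {- int M..int M}"
      using abs_le_jexp[OF jk] by (auto simp: M_def) (smt (verit) of_nat_mono)+
    have "(\<Sum>n = - int M..int M. ?t n) $ d = (\<Sum>n = - int M..int M. if jexp j k n = d then (-c) powi n else 0)"
      by (auto simp: fps_sum_nth fps_X_power_iff intro!: sum.cong)
    also have "\<dots> = (\<Sum>n | jexp j k n = d. (-c) powi n)"
      using sub by (intro sum.mono_neutral_cong_right) auto
    finally show "(\<Sum>n = - int M..int M. ?t n) $ d = theta c j k $ d"
      by (simp add: theta_def)
  qed
  finally show "fps_agree N (?E * qpinf c j k * qpinf (inverse c) (k - j) k) (theta c j k)" .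
qed

section \<open>Five-dissections\<close>

text \<open>\<open>jexp 1 1 n\<close> is the triangular number n*(n+1)/2.\<close>

lemma jexp_1_1_reflect: "jexp 1 1 (-1 - n) = jexp 1 1 n"
proof -
  have "2 * int (jexp 1 1 (-1 - n)) = 2 * int (jexp 1 1 n)"
    unfolding two_int_jexp[OF zero_less_one order_refl] by (simp add: algebra_simps)
  then show ?thesis by simp
qed

lemma jexp_1_1_mod5_0: "jexp 1 1 (5 * m) = jexp 15 25 m"
proof -
  have "2 * int (jexp 1 1 (5 * m)) = 2 * int (jexp 15 25 m)"
    by (subst (1 2) two_int_jexp) (simp_all add: algebra_simps)
  then show ?thesis by simp
qed

lemma jexp_1_1_mod5_1: "jexp 1 1 (5 * m + 1) = Suc (jexp 20 25 m)"
proof -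
  have "2 * int (jexp 1 1 (5 * m + 1)) = 2 * int (jexp 20 25 m) + 2"
    by (subst (1 2) two_int_jexp) (simp_all add: algebra_simps)
  then show ?thesis by simp
qed

text \<open>Writing n = 5m + r turns (-w)^n into (-w)^r (-1)^m. The reflection n -> -1-n sends (m,
  r) to (-1-m, 4-r) and flips the sign of (-1)^m, so classes 0 and 4 merge into 1 - w^4, and classes
  1 and 3 into w - w^3.\<close>

lemma theta_dissection:
  fixes w :: "'a::field_char_0"
  assumes "w ^ 5 = 1"
  shows "theta w 1 1 = fps_const (1 - w ^ 4) * theta 1 15 25
    - fps_const (w - w ^ 3) * (fps_X * theta 1 20 25)"
proof (rule fps_ext)
  fix d
  have w0: "w \<noteq> 0" using assms by auto
  define S where "S = (\<lambda>r. \<Sum>m | jexp 1 1 (5 * m + r) = d. (-1) powi m :: 'a)"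
  have fin: "finite {n. jexp 1 1 n = d}"
    by (rule finite_jexp_eq) auto
  have pw: "(-w) powi (5 * m + int r) = (-w) ^ r * (-1) powi m" for m r
  proof -
    have "(-w) powi (5 * m) = ((-w) powi 5) powi m" by (rule power_int_mult)
    also have "(-w) powi 5 = -1" using assms by simp
    finally show ?thesis using w0 by (simp add: power_int_add)
  qed
  have S_reflect: "S (4 - r) = - S r" for r
  proof -
    have e: "jexp 1 1 (5 * (-1 - m) + (4 - r)) = jexp 1 1 (5 * m + r)" for m
      using jexp_1_1_reflect[of "5 * m + r"] by (simp add: algebra_simps)
    have e': "jexp 1 1 (5 * (-1 - m) + r) = jexp 1 1 (5 * m + (4 - r))" for m
      using jexp_1_1_reflect[of "5 * m + (4 - r)"] by (simp add: algebra_simps)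
    have involution: "-1 - (-1 - m) = m" for m :: int by simp
    have sgn: "(-1) powi (-1 - m) = - ((-1) powi m :: 'a)" for m
    proof -
      have "(-1) powi m * (-1) powi m = ((-1) * (-1) :: 'a) powi m"
        by (rule power_int_mult_distrib[symmetric])
      then have "(-1) powi m * (-1) powi m = (1 :: 'a)" by simp
      moreover have "(-1) powi (-1 - m) = (-1) powi (-1) / ((-1) powi m :: 'a)"
        by (rule power_int_diff) simp
      ultimately show ?thesis by (simp add: divide_eq_eq)
    qed
    have "- S r = (\<Sum>m | jexp 1 1 (5 * m + r) = d. (-1) powi (-1 - m))"
      unfolding S_def sgn by (rule sum_negf[symmetric])
    also have "\<dots> = S (4 - r)"
      unfolding S_def
      by (rule sum.reindex_bij_witness[of _ "\<lambda>m. -1 - m" "\<lambda>m. -1 - m"])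
        (simp_all only: mem_Collect_eq e e' involution)
    finally show ?thesis by simp
  qed
  \<comment> \<open>The last equation makes residue class 2 vanish, since the characteristic is
    zero.\<close>
  have S_refl: "S 4 = - S 0" "S 3 = - S 1" "S 2 = - S 2"
    using S_reflect[of 0] S_reflect[of 1] S_reflect[of 2] by simp_all
  have "theta w 1 1 $ d = (\<Sum>n | jexp 1 1 n = d. (-w) powi n)"
    by (simp add: theta_def)
  also have "\<dots> = (\<Sum>r<5. \<Sum>n | jexp 1 1 n = d \<and> nat (n mod 5) = r. (-w) powi n)"
    using sum.group[OF fin, of "{..<5::nat}" "\<lambda>n. nat (n mod 5)" "\<lambda>n. (-w) powi n"]
    by (simp add: image_subset_iff nat_less_iff)
  also have "\<dots> = (\<Sum>r<5. (-w) ^ r * S (int r))"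
  proof (intro sum.cong refl)
    fix r :: nat assume r: "r \<in> {..<5}"
    have "(\<Sum>n | jexp 1 1 n = d \<and> nat (n mod 5) = r. (-w) powi n)
        = (\<Sum>m | jexp 1 1 (5 * m + int r) = d. (-w) powi (5 * m + int r))"
      using r by (intro sum.reindex_bij_witness[of _ "\<lambda>m. 5 * m + int r" "\<lambda>n. n div 5"])
        (auto simp: mult_div_mod_eq)
    also have "\<dots> = (-w) ^ r * S (int r)"
      unfolding S_def sum_distrib_left by (intro sum.cong refl pw)
    finally show "(\<Sum>n | jexp 1 1 n = d \<and> nat (n mod 5) = r. (-w) powi n) = (-w) ^ r * S (int r)" .
  qed
  also have "\<dots> = S 0 - w * S 1 + w ^ 2 * S 2 - w ^ 3 * S 3 + w ^ 4 * S 4"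
    by (simp add: eval_nat_numeral)
  also have "S 0 - w * S 1 + w ^ 2 * S 2 - w ^ 3 * S 3 + w ^ 4 * S 4
      = (1 - w ^ 4) * S 0 - (w - w ^ 3) * S 1"
    using S_refl by (simp add: algebra_simps)
  also have "S 0 = theta 1 15 25 $ d"
    by (simp add: S_def theta_def jexp_1_1_mod5_0 del: One_nat_def)
  also have "S 1 = (fps_X * theta 1 20 25) $ d"
    by (cases d) (simp_all add: S_def theta_def jexp_1_1_mod5_1 del: One_nat_def)
  finally show "theta w 1 1 $ d = (fps_const (1 - w ^ 4) * theta 1 15 25
    - fps_const (w - w ^ 3) * (fps_X * theta 1 20 25)) $ d"
    by simp
qed

text \<open>The triple product at c = w, j = k = 1 has the surplus factor 1 -
  \<open>inverse w\<close> = 1 - w^4. It also divides the second coefficient of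
  \<open>theta_dissection\<close>, and it cancels because w \<noteq> 1. The two remaining series are
  turned back into products by the triple product at c = 1.\<close>

lemma triple_product_root_dissection:
  fixes w :: "'a::field_char_0"
  assumes "w ^ 5 = 1" "w \<noteq> 1"
  shows "qpinf 1 1 1 * qpinf w 1 1 * qpinf (w ^ 4) 1 1
    = qpinf 1 25 25 * qpinf 1 15 25 * qpinf 1 10 25
      + fps_const (w ^ 2 + w ^ 3) * (fps_X * (qpinf 1 25 25 * qpinf 1 20 25 * qpinf 1 5 25))"
proof -
  have w0: "w \<noteq> 0" using assms by auto
  have w5: "w * w ^ 4 = 1" using assms by (simp add: eval_nat_numeral)
  then have inv: "inverse w = w ^ 4" by (rule inverse_unique)
  have "w ^ 4 \<noteq> 1" using w5 assms(2) by auto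
  then have u: "fps_const (1 - w ^ 4) \<noteq> 0" by simp
  have c: "w - w ^ 3 = - ((1 - w ^ 4) * (w ^ 2 + w ^ 3))"
  proof -
    have "w ^ 4 * w ^ 2 = w" "w ^ 4 * w ^ 3 = w ^ 2"
      using assms by (simp_all add: eval_nat_numeral)
    then show ?thesis by (simp add: algebra_simps)
  qed
  have "fps_const (1 - w ^ 4) * (qpinf 1 1 1 * qpinf w 1 1 * qpinf (w ^ 4) 1 1)
      = qpinf 1 1 1 * qpinf w 1 1 * qpinf (inverse w) (1 - 1) 1"
    using qpinf_split_first[of 1 "inverse w" 0]
    by (simp add: inv mult_ac fps_const_sub[symmetric] del: fps_const_sub)
  also have "\<dots> = theta w 1 1"
    by (rule triple_product) (use w0 in auto)
  also have "\<dots> = fps_const (1 - w ^ 4) * (theta 1 15 25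
      + fps_const (w ^ 2 + w ^ 3) * (fps_X * theta 1 20 25))"
  proof -
    have "a * f - (- (a * b)) * g = a * (f + b * g)" for a b f g :: "'a fps"
      by (simp add: algebra_simps)
    then show ?thesis
      unfolding theta_dissection[OF assms(1)] c by (simp flip: fps_const_mult fps_const_neg)
  qed
  finally have "qpinf 1 1 1 * qpinf w 1 1 * qpinf (w ^ 4) 1 1
      = theta 1 15 25 + fps_const (w ^ 2 + w ^ 3) * (fps_X * theta 1 20 25)"
    using u by simp
  moreover have "theta 1 15 25 = qpinf 1 25 25 * qpinf 1 15 25 * qpinf (1::'a) 10 25"
    using triple_product[of 15 25 "1::'a"] by simp
  moreover have "theta 1 20 25 = qpinf 1 25 25 * qpinf 1 20 25 * qpinf (1::'a) 5 25"
    using triple_product[of 20 25 "1::'a"] by simp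
  ultimately show ?thesis by simp
qed

text \<open>Pairing z with z^4 and z^2 with z^3 leaves quadratics in x whose middle coefficients
  satisfy s + t = s*t = -1. The argument is purely polynomial, so it applies to constants in a ring
  of power series.\<close>

lemma prod_fifth_roots:
  fixes z x :: "'a::comm_ring_1"
  assumes "z ^ 5 = 1" "1 + z + z ^ 2 + z ^ 3 + z ^ 4 = 0"
  shows "(1 - x) * (1 - z * x) * (1 - z ^ 2 * x) * (1 - z ^ 3 * x) * (1 - z ^ 4 * x) = 1 - x ^ 5"
proof -
  define s where "s = z + z ^ 4"
  define t where "t = z ^ 2 + z ^ 3"
  have p: "z * z ^ 4 = 1" "z ^ 2 * z ^ 3 = 1"
    using assms(1) by (simp_all add: eval_nat_numeral mult.assoc)
  have st0: "s + t + 1 = 0" using assms(2) by (simp add: s_def t_def ac_simps)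
  have "s = (s + t + 1) - 1 - t" by simp
  then have st: "s = - 1 - t" unfolding st0 by simp
  have "s * t = z ^ 3 + z ^ 4 + z ^ 5 * z + z ^ 5 * z ^ 2"
    by (simp add: s_def t_def eval_nat_numeral algebra_simps)
  also have "\<dots> = (s + t + 1) - 1" by (simp add: assms(1) s_def t_def)
  also have "\<dots> = - 1" unfolding st0 by simp
  finally have t2: "t * t = 1 - t"
    by (simp add: st algebra_simps)
  have 1: "(1 - z * x) * (1 - z ^ 4 * x) = 1 - s * x + (z * z ^ 4) * x ^ 2"
    by (simp add: s_def power2_eq_square algebra_simps)
  have 2: "(1 - z ^ 2 * x) * (1 - z ^ 3 * x) = 1 - t * x + (z ^ 2 * z ^ 3) * x ^ 2"
    by (simp add: t_def power2_eq_square algebra_simps)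
  have "(1 - x) * (1 - z * x) * (1 - z ^ 2 * x) * (1 - z ^ 3 * x) * (1 - z ^ 4 * x)
      = (1 - x) * ((1 - z * x) * (1 - z ^ 4 * x)) * ((1 - z ^ 2 * x) * (1 - z ^ 3 * x))"
    by (simp only: mult_ac)
  also have "\<dots> = (1 - x) * ((1 + x ^ 2) * (1 + x ^ 2) + x * (1 + x ^ 2) - (t * t + t) * x ^ 2)"
    unfolding 1 2 p st by (simp add: power2_eq_square algebra_simps)
  also have "\<dots> = 1 - x ^ 5"
    unfolding t2 by (simp add: eval_nat_numeral algebra_simps)
  finally show ?thesis .
qed

lemma qpinf_fifth_roots:
  fixes z :: "'a::idom"
  assumes "z ^ 5 = 1" "1 + z + z ^ 2 + z ^ 3 + z ^ 4 = 0"
  shows "qpinf 1 1 1 * qpinf z 1 1 * qpinf (z ^ 2) 1 1 * qpinf (z ^ 3) 1 1 * qpinf (z ^ 4) 1 1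
    = qpinf 1 5 5" (is "?L = _")
proof (rule fps_eqI_agree)
  fix N
  let ?q = "\<lambda>c. qpfin c 1 1 (Suc N) :: 'a fps"
  have "fps_agree N ?L (?q 1 * ?q z * ?q (z ^ 2) * ?q (z ^ 3) * ?q (z ^ 4))"
    by (intro fps_agree_mult qpinf_agree) auto
  also have "?q 1 * ?q z * ?q (z ^ 2) * ?q (z ^ 3) * ?q (z ^ 4) = qpfin 1 5 5 (Suc N)"
    unfolding qpfin_def prod.distrib[symmetric]
  proof (intro prod.cong refl)
    fix i
    let ?z = "fps_const z"
    have "?z ^ 5 = 1" "1 + ?z + ?z ^ 2 + ?z ^ 3 + ?z ^ 4 = 0"
      using assms by (simp_all add: fps_const_power flip: fps_const_1_eq_1)
    note roots = prod_fifth_roots[OF this, of "fps_X ^ (1 + 1 * i)"]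
    have "(fps_X ^ (1 + 1 * i)) ^ 5 = (fps_X ^ (5 + 5 * i) :: 'a fps)"
      unfolding power_mult[symmetric] by (simp add: mult.commute)
    with roots show "(1 - fps_const 1 * fps_X ^ (1 + 1 * i)) * (1 - ?z * fps_X ^ (1 + 1 * i))
        * (1 - fps_const (z ^ 2) * fps_X ^ (1 + 1 * i)) * (1 - fps_const (z ^ 3) * fps_X ^ (1 + 1 * i))
        * (1 - fps_const (z ^ 4) * fps_X ^ (1 + 1 * i)) = 1 - fps_const 1 * fps_X ^ (5 + 5 * i)"
      by (simp only: fps_const_power fps_const_1_eq_1 mult_1_left)
  qed
  also have "fps_agree N (qpfin 1 5 5 (Suc N)) (qpinf (1::'a) 5 5)"
    by (intro fps_agree_sym[OF qpinf_agree]) auto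
  finally show "fps_agree N ?L (qpinf 1 5 5)" .
qed

text \<open>In the product of the dissections for z and z^2, one copy of \<open>qpinf 1 1 1\<close>
  joins the four root products to give \<open>qpinf 1 5 5\<close> and the other remains. The
  auxiliary root disappears from the result because s and t are the two roots of x^2 + x -
  1.\<close>

lemma euler_dissection:
  fixes z :: "'a::field_char_0"
  assumes z: "z ^ 5 = 1" "1 + z + z ^ 2 + z ^ 3 + z ^ 4 = 0"
  defines "A \<equiv> qpinf 1 25 25 * qpinf 1 15 25 * qpinf (1::'a) 10 25"
    and "B \<equiv> qpinf 1 25 25 * qpinf 1 20 25 * qpinf (1::'a) 5 25"
  shows "qpinf 1 1 1 * qpinf 1 5 5 = A ^ 2 - fps_X * A * B - fps_X ^ 2 * B ^ 2"
proof -
  have z1: "z \<noteq> 1" using z(2) by auto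
  have z2: "(z ^ 2) ^ 5 = 1" "z ^ 2 \<noteq> 1"
  proof -
    show "(z ^ 2) ^ 5 = 1" using z(1) by (metis power_mult mult.commute power_one)
    show "z ^ 2 \<noteq> 1"
    proof
      assume "z ^ 2 = 1"
      moreover have "z ^ 5 = z ^ 2 * z ^ 2 * z" by (simp add: eval_nat_numeral)
      ultimately show False using z(1) z1 by simp
    qed
  qed
  have p: "(z ^ 2) ^ 2 = z ^ 4" "(z ^ 2) ^ 3 = z" "(z ^ 2) ^ 4 = z ^ 3"
    using z(1) by (simp_all add: eval_nat_numeral)
  define s where "s = z ^ 2 + z ^ 3"
  define t where "t = z ^ 4 + z"
  have st: "s + t = -1" "s * t = -1"
    using z unfolding s_def t_def by algebra+
  have "qpinf 1 1 1 * qpinf 1 5 5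
      = (qpinf 1 1 1 * qpinf z 1 1 * qpinf (z ^ 4) 1 1)
      * (qpinf 1 1 1 * qpinf (z ^ 2) 1 1 * qpinf ((z ^ 2) ^ 4) 1 1)"
    unfolding qpinf_fifth_roots[OF z, symmetric] p(3) by (simp only: mult_ac)
  also have "\<dots> = (A + fps_const s * (fps_X * B)) * (A + fps_const t * (fps_X * B))"
    unfolding triple_product_root_dissection[OF z(1) z1] triple_product_root_dissection[OF z2] p(1,2)
    unfolding s_def t_def A_def B_def ..
  also have "\<dots> = A ^ 2 + fps_const (s + t) * (fps_X * A * B) + fps_const (s * t) * (fps_X ^ 2 * B ^ 2)"
    by (simp add: algebra_simps power2_eq_square flip: fps_const_add fps_const_mult)
  finally show ?thesis
    unfolding st by (simp flip: fps_const_neg)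
qed

text \<open>Used to state each claimed quotient, after q -> q^5, as a relation free of
  division.\<close>

lemma quotient_compose_mult:
  fixes f g h :: "'a::field fps"
  assumes "g $ 0 \<noteq> 0" "h $ 0 = 0"
  shows "((f / g) oo h) * (g oo h) = f oo h"
proof -
  have "f / g * g = f"
    using assms(1) by (simp add: fps_divide_unit mult.assoc inverse_mult_eq_1)
  then show ?thesis
    using fps_compose_mult_distrib[OF assms(2)] by metis
qed

section \<open>Evaluation of Laurent polynomial coefficients\<close>

unbundle fps_syntax

definition laurent_poly :: "'a::field fls \<Rightarrow> bool" where
  "laurent_poly f \<longleftrightarrow> finite {m. f $$ m \<noteq> 0}"

text \<open>For infinite support this sum takes the default value 0, which is why the homomorphism
  laws below are restricted to Laurent polynomials.\<close>

definition fls_ev :: "'a::field \<Rightarrow> 'a fls \<Rightarrow> 'a" where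
  "fls_ev z f = (\<Sum>m | f $$ m \<noteq> 0. f $$ m * z powi m)"

lemma fls_ev_superset:
  "finite S \<Longrightarrow> {m. f $$ m \<noteq> 0} \<subseteq> S \<Longrightarrow> fls_ev z f = (\<Sum>m\<in>S. f $$ m * z powi m)"
  unfolding fls_ev_def by (intro sum.mono_neutral_left) auto

lemma laurent_poly_add: "laurent_poly f \<Longrightarrow> laurent_poly g \<Longrightarrow> laurent_poly (f + g)"
  unfolding laurent_poly_def
  by (rule finite_subset[of _ "{m. f $$ m \<noteq> 0} \<union> {m. g $$ m \<noteq> 0}"]) auto

lemma fls_ev_add:
  assumes "laurent_poly f" "laurent_poly g"
  shows "fls_ev z (f + g) = fls_ev z f + fls_ev z g"
proof -
  let ?S = "{m. f $$ m \<noteq> 0} \<union> {m. g $$ m \<noteq> 0}"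
  have "finite ?S" using assms by (simp add: laurent_poly_def)
  moreover have "{m. (f + g) $$ m \<noteq> 0} \<subseteq> ?S" "{m. f $$ m \<noteq> 0} \<subseteq> ?S" "{m. g $$ m \<noteq> 0} \<subseteq> ?S"
    by auto
  ultimately show ?thesis
    by (simp add: fls_ev_superset[of ?S] ring_distribs sum.distrib)
qed

lemma laurent_poly_0 [simp]: "laurent_poly 0" and fls_ev_0 [simp]: "fls_ev z 0 = 0"
  by (simp_all add: laurent_poly_def fls_ev_def)

lemma laurent_poly_sum: "(\<And>i. i \<in> A \<Longrightarrow> laurent_poly (f i)) \<Longrightarrow> laurent_poly (\<Sum>i\<in>A. f i)"
  by (induction A rule: infinite_finite_induct) (auto intro: laurent_poly_add)

lemma fls_ev_sum:
  "(\<And>i. i \<in> A \<Longrightarrow> laurent_poly (f i)) \<Longrightarrow> fls_ev z (\<Sum>i\<in>A. f i) = (\<Sum>i\<in>A. fls_ev z (f i))"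
  by (induction A rule: infinite_finite_induct) (auto simp: fls_ev_add laurent_poly_sum)

lemma laurent_poly_shift:
  assumes "laurent_poly g"
  shows "laurent_poly (fls_const a * fls_shift (-m) g)"
proof -
  have "{n. (fls_const a * fls_shift (-m) g) $$ n \<noteq> 0} \<subseteq> (\<lambda>n. n + m) ` {n. g $$ n \<noteq> 0}"
    by (auto simp: image_iff intro!: exI[of _ "_ - m"])
  then show ?thesis
    using assms unfolding laurent_poly_def by (auto intro: finite_subset)
qed

lemma fls_ev_shift:
  assumes "laurent_poly g" "z \<noteq> 0"
  shows "fls_ev z (fls_const a * fls_shift (-m) g) = a * z powi m * fls_ev z g"
proof -
  let ?S = "{n. g $$ n \<noteq> 0}"
  have "fls_ev z (fls_const a * fls_shift (-m) g)
      = (\<Sum>n\<in>(\<lambda>n. n + m) ` ?S. (fls_const a * fls_shift (-m) g) $$ n * z powi n)"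
    using assms(1) by (intro fls_ev_superset)
      (auto simp: laurent_poly_def image_iff intro!: exI[of _ "_ - m"])
  also have "\<dots> = (\<Sum>n\<in>?S. a * z powi m * (g $$ n * z powi n))"
    using assms(2) by (subst sum.reindex) (auto simp: inj_on_def power_int_add mult_ac intro!: sum.cong)
  also have "\<dots> = a * z powi m * fls_ev z g"
    by (simp add: fls_ev_def sum_distrib_left)
  finally show ?thesis .
qed

text \<open>A product becomes a finite combination of shifts of g, so closure under multiplication
  and multiplicativity of evaluation follow from additivity and the monomial case.\<close>

lemma laurent_poly_mult_expand:
  assumes "laurent_poly f"
  shows "f * g = (\<Sum>m | f $$ m \<noteq> 0. fls_const (f $$ m) * fls_shift (-m) g)"
proof -
  have fin: "finite {m. f $$ m \<noteq> 0}" using assms by (simp add: laurent_poly_def)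
  have "f = (\<Sum>m | f $$ m \<noteq> 0. fls_const (f $$ m) * fls_X_intpow m)"
  proof (rule fls_eqI)
    fix n
    have "(\<Sum>m | f $$ m \<noteq> 0. fls_const (f $$ m) * fls_X_intpow m) $$ n
        = (\<Sum>m | f $$ m \<noteq> 0. if m = n then f $$ m else 0)"
      by (auto simp: fls_nth_sum intro!: sum.cong)
    also have "\<dots> = f $$ n" using fin by (auto simp: sum.delta)
    finally show "f $$ n = (\<Sum>m | f $$ m \<noteq> 0. fls_const (f $$ m) * fls_X_intpow m) $$ n" by simp
  qed
  then have "f * g = (\<Sum>m | f $$ m \<noteq> 0. fls_const (f $$ m) * fls_X_intpow m) * g" by simp
  then show ?thesis
    by (simp only: sum_distrib_right mult.assoc fls_X_intpow_times_conv_shift(1))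
qed

lemma laurent_poly_mult:
  assumes "laurent_poly f" "laurent_poly g"
  shows "laurent_poly (f * g)"
  unfolding laurent_poly_mult_expand[OF assms(1)] using assms
  by (intro laurent_poly_sum laurent_poly_shift)

lemma fls_ev_mult:
  assumes "laurent_poly f" "laurent_poly g" "z \<noteq> 0"
  shows "fls_ev z (f * g) = fls_ev z f * fls_ev z g"
  unfolding laurent_poly_mult_expand[OF assms(1)] using assms
  by (simp add: fls_ev_sum laurent_poly_shift fls_ev_shift sum_distrib_right)
     (simp add: fls_ev_def sum_distrib_right)

lemma laurent_poly_const [simp]: "laurent_poly (fls_const c)"
  unfolding laurent_poly_def by (rule finite_subset[of _ "{0}"]) auto

lemma laurent_poly_1 [simp]: "laurent_poly 1"
  using laurent_poly_const[of 1] by simp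

lemma laurent_poly_X [simp]: "laurent_poly fls_X"
  unfolding laurent_poly_def by (rule finite_subset[of _ "{1}"]) auto

lemma laurent_poly_X_inv [simp]: "laurent_poly fls_X_inv"
  unfolding laurent_poly_def by (rule finite_subset[of _ "{-1}"]) auto

lemma fls_ev_const [simp]: "fls_ev z (fls_const c) = c"
  by (subst fls_ev_superset[of "{0}"]) auto

lemma fls_ev_1 [simp]: "fls_ev z 1 = 1"
  using fls_ev_const[of z 1] by simp

lemma fls_ev_X [simp]: "fls_ev z fls_X = z"
  by (subst fls_ev_superset[of "{1}"]) auto

lemma fls_ev_X_inv [simp]: "fls_ev z fls_X_inv = inverse z"
  by (subst fls_ev_superset[of "{-1}"]) (auto simp: power_int_minus)

lemma laurent_poly_minus: "laurent_poly f \<Longrightarrow> laurent_poly (- f)"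
  by (simp add: laurent_poly_def)

lemma fls_ev_minus [simp]: "fls_ev z (- f) = - fls_ev z f"
  by (simp add: fls_ev_def sum_negf)

section \<open>Power series in q with Laurent polynomial coefficients in z\<close>

definition laurent_poly_coeffs :: "'a::field fls fps \<Rightarrow> bool" where
  "laurent_poly_coeffs F \<longleftrightarrow> (\<forall>n. laurent_poly (F $ n))"

definition fps_ev :: "'a::field \<Rightarrow> 'a fls fps \<Rightarrow> 'a fps" where
  "fps_ev z F = Abs_fps (\<lambda>n. fls_ev z (F $ n))"

lemma laurent_poly_coeffs_mult:
  "laurent_poly_coeffs F \<Longrightarrow> laurent_poly_coeffs G \<Longrightarrow> laurent_poly_coeffs (F * G)"
  by (auto simp: laurent_poly_coeffs_def fps_mult_nth intro!: laurent_poly_sum laurent_poly_mult)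

lemma fps_ev_mult:
  assumes "laurent_poly_coeffs F" "laurent_poly_coeffs G" "z \<noteq> 0"
  shows "fps_ev z (F * G) = fps_ev z F * fps_ev z G"
  using assms
  by (auto simp: laurent_poly_coeffs_def fps_ev_def fps_eq_iff fps_mult_nth fls_ev_sum
      laurent_poly_mult fls_ev_mult)

lemma laurent_poly_coeffs_factor:
  assumes "laurent_poly c"
  shows "laurent_poly_coeffs (1 - fps_const c * fps_X ^ m)"
  using assms by (auto simp: laurent_poly_coeffs_def fps_X_power_iff diff_conv_add_uminus
      simp del: add_uminus_conv_diff intro!: laurent_poly_add laurent_poly_minus)

lemma fps_ev_factor:
  assumes "laurent_poly c"
  shows "fps_ev z (1 - fps_const c * fps_X ^ m) = 1 - fps_const (fls_ev z c) * fps_X ^ m"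
proof (rule fps_ext)
  fix n
  show "fps_ev z (1 - fps_const c * fps_X ^ m) $ n = (1 - fps_const (fls_ev z c) * fps_X ^ m) $ n"
    using fls_ev_add[of 1 "- c" z] assms
    by (auto simp: fps_ev_def fps_X_power_iff laurent_poly_minus)
qed

lemma qpfin_ev:
  assumes "laurent_poly c" "z \<noteq> 0"
  shows "laurent_poly_coeffs (qpfin c j k M) \<and> fps_ev z (qpfin c j k M) = qpfin (fls_ev z c) j k M"
proof (induction M)
  case 0
  show ?case
    using laurent_poly_coeffs_factor[of 0 0] fps_ev_factor[of 0 z 0] by (simp add: qpfin_def)
next
  case (Suc M)
  then show ?case
    using assms laurent_poly_coeffs_factor[of c] fps_ev_factor[of c z]
    by (simp add: qpfin_def laurent_poly_coeffs_mult fps_ev_mult)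
qed

lemma qpinf_nth: "qpinf c j k $ n = qpfin c j k (Suc n) $ n"
  by (simp add: qpinf_def qpfin_def lessThan_Suc_atMost)

lemma laurent_poly_coeffs_qpinf:
  "laurent_poly c \<Longrightarrow> laurent_poly_coeffs (qpinf c j k)"
  \<comment> \<open>The evaluation point 1 is just a nonzero placeholder.\<close>
  using qpfin_ev[of c 1] by (simp add: laurent_poly_coeffs_def qpinf_nth)

lemma fps_ev_qpinf:
  "laurent_poly c \<Longrightarrow> z \<noteq> 0 \<Longrightarrow> fps_ev z (qpinf c j k) = qpinf (fls_ev z c) j k"
  using qpfin_ev[of c z] by (simp add: fps_eq_iff fps_ev_def qpinf_nth)

text \<open>With constant term 1 the recursion for the coefficients of the inverse involves only
  sums and products of earlier ones, so no Laurent polynomial is ever inverted.\<close>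

lemma laurent_poly_coeffs_inverse:
  fixes F :: "'a::field fls fps"
  assumes "laurent_poly_coeffs F" "F $ 0 = 1"
  shows "laurent_poly_coeffs (inverse F)"
  unfolding laurent_poly_coeffs_def
proof
  fix n
  show "laurent_poly (inverse F $ n)"
  proof (induction n rule: less_induct)
    case (less n)
    show ?case
    proof (cases "n = 0")
      case False
      have "F * inverse F = 1" using assms(2) by (intro inverse_mult_eq_1') simp
      then have "0 = (F * inverse F) $ n" using False by simp
      also have "\<dots> = F $ 0 * inverse F $ n + (\<Sum>i=1..n. F $ i * inverse F $ (n - i))"
        by (simp add: fps_mult_nth sum.atLeast_Suc_atMost)
      finally have "inverse F $ n = - (\<Sum>i=1..n. F $ i * inverse F $ (n - i))"
        using assms(2) by (simp add: eq_neg_iff_add_eq_0)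
      also have "laurent_poly \<dots>"
        using assms(1) less
        by (intro laurent_poly_minus laurent_poly_sum laurent_poly_mult)
           (auto simp: laurent_poly_coeffs_def)
      finally show ?thesis .
    qed (use assms in simp)
  qed
qed

text \<open>The infinite sum over m has finite support and is therefore the evaluation of a Laurent
  polynomial. Evaluation is multiplicative, so the defining quotient can be specialised once its
  denominator is moved to the other side.\<close>

lemma M2_gen_ev:
  assumes "z \<noteq> 0"
  shows "Abs_fps (\<lambda>n. \<Sum>\<^sub>\<infinity>m::int. M2 m n * z powi m) * (qpinf z 2 2 * qpinf (inverse z) 2 2)
    = qpinf (-1) 1 2 * qpinf 1 2 2"
proof -
  define D :: "complex fls fps" where "D = qpinf fls_X 2 2 * qpinf fls_X_inv 2 2"
  define G :: "complex fls fps" where "G = qpinf (-1) 1 2 * qpinf 1 2 2"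
  have D0: "D $ 0 = 1" by (simp add: D_def qpinf_nth_0)
  have D: "laurent_poly_coeffs D"
    unfolding D_def by (intro laurent_poly_coeffs_mult laurent_poly_coeffs_qpinf) simp_all
  have G: "laurent_poly_coeffs G"
    unfolding G_def
    by (intro laurent_poly_coeffs_mult laurent_poly_coeffs_qpinf laurent_poly_minus) simp_all
  have M2G: "M2_gen = G * inverse D"
    unfolding M2_gen_def D_def[symmetric] G_def[symmetric] using D0 by (simp add: fps_divide_unit)
  have M: "laurent_poly_coeffs M2_gen"
    unfolding M2G by (intro laurent_poly_coeffs_mult laurent_poly_coeffs_inverse G D D0)
  have "(\<Sum>\<^sub>\<infinity>m::int. M2 m n * z powi m) = fls_ev z (M2_gen $ n)" for n
  proof -
    have "(\<Sum>\<^sub>\<infinity>m::int. M2 m n * z powi m)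
        = (\<Sum>\<^sub>\<infinity>m\<in>{m. M2_gen $ n $$ m \<noteq> 0}. M2_gen $ n $$ m * z powi m)"
      by (rule infsum_cong_neutral) (auto simp: M2_def)
    also have "\<dots> = fls_ev z (M2_gen $ n)"
      using M by (simp add: laurent_poly_coeffs_def laurent_poly_def fls_ev_def)
    finally show ?thesis .
  qed
  then have ev: "Abs_fps (\<lambda>n. \<Sum>\<^sub>\<infinity>m::int. M2 m n * z powi m) = fps_ev z M2_gen"
    by (simp add: fps_ev_def)
  have "Abs_fps (\<lambda>n. \<Sum>\<^sub>\<infinity>m::int. M2 m n * z powi m) * (qpinf z 2 2 * qpinf (inverse z) 2 2)
      = fps_ev z M2_gen * fps_ev z D"
    unfolding ev using assms by (simp add: D_def fps_ev_mult laurent_poly_coeffs_qpinf fps_ev_qpinf)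
  also have "\<dots> = fps_ev z (M2_gen * D)"
    using M D assms by (simp add: fps_ev_mult)
  also have "M2_gen * D = G"
    unfolding M2G mult.assoc using D0 by (simp add: inverse_mult_eq_1)
  also have "fps_ev z G = qpinf (-1) 1 2 * qpinf 1 2 2"
    using assms laurent_poly_minus[of "1 :: complex fls"]
    by (simp add: G_def fps_ev_mult laurent_poly_coeffs_qpinf fps_ev_qpinf)
  finally show ?thesis .
qed

section \<open>The five-dissection of the M2 generating function\<close>

text \<open>Doubling the step makes it even, as \<open>qpinf_compose_uminus_X\<close> requires: all
  exponents in one factor then have the same parity and pick up the same sign under q -> -q.\<close>

lemma qpinf_split_double: "k > 0 \<Longrightarrow> qpinf c j k = qpinf c j (2 * k) * qpinf c (j + k) (2 * k)"
  using qpinf_split_mod[of k 2 c j] by (simp add: eval_nat_numeral algebra_simps)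

lemma qpinf_split_5:
  "qpinf c j k = qpinf c j (5 * k) * qpinf c (j + k) (5 * k) * qpinf c (j + 2 * k) (5 * k)
     * qpinf c (j + 3 * k) (5 * k) * qpinf c (j + 4 * k) (5 * k)" if "k > 0"
  using qpinf_split_mod[OF that, of 5 c j] by (simp add: eval_nat_numeral algebra_simps)

lemma qpinf_compose_X_power:
  fixes c :: "'a::idom"
  assumes "k > 0" "m > 0"
  shows "qpinf c j k oo fps_X ^ m = qpinf c (m * j) (m * k)"
  using qpinf_compose[OF assms, of 1 c j] by simp

lemma qpinf_compose_uminus_X:
  fixes c :: "'a::idom"
  assumes "k > 0" "even k"
  shows "qpinf c j k oo (- fps_X) = qpinf (c * (-1) ^ j) j k"
  using qpinf_compose[OF assms(1), of 1 "-1" c j] assms(2) by (simp flip: fps_const_neg)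

text \<open>Here \<open>pj\<close> and \<open>nj\<close> stand for (q^j;q^50)_inf and
  (-q^j;q^50)_inf. Write P = \<open>p50 * p30 * p20\<close> and Q = \<open>p50 * p40 * p10\<close>.
  The denominators divide K, and K times M0, M1, M2b is A^2 P, A B P, B^2 P, while K times M2a, M3,
  M4 is A^2 Q, A B Q, B^2 Q. Only X^2 is reached from both P and Q, hence the two terms
  there.\<close>

lemma five_dissection_identity:
  fixes X c n5 n15 n25 n35 n45 p10 p20 p30 p40 p50 :: "'a::comm_ring_1"
  assumes M0: "M0 * (n5 * p20 * p30 * n45) = n15 * n25 * n35 * p50"
    and M1: "M1 * (p10 * p40) = n25 * p50"
    and M2a: "M2a * (n5 * p20 * p20 * p30 * p30 * n45) = p10 * n15 * n25 * n35 * p40 * p50"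
    and M2b: "M2b * (p10 * p10 * n15 * n35 * p40 * p40) = n5 * p20 * n25 * p30 * n45 * p50"
    and M3: "M3 * (p20 * p30) = n25 * p50"
    and M4: "M4 * (p10 * n15 * n35 * p40) = n5 * n25 * n45 * p50"
  defines "A \<equiv> (n25 * p50) * (n15 * p40) * (p10 * n35)"
    and "B \<equiv> (n25 * p50) * (p20 * n45) * (n5 * p30)"
    and "K \<equiv> (p10 * p20 * p30 * p40 * p50) * (n5 * p10 * n15 * p20 * n25 * p30 * n35 * p40 * n45 * p50)"
  shows "(M0 + X * M1 + X ^ 2 * (c * M2a - M2b) + X ^ 3 * (c * M3) + X ^ 4 * (- c * M4)) * K
    = (A ^ 2 + X * A * B - X ^ 2 * B ^ 2) * (p50 * p30 * p20 + c * (X ^ 2 * (p50 * p40 * p10)))"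
proof -
  have 0: "M0 * K = A ^ 2 * (p50 * p30 * p20)"
  proof -
    have "M0 * K = (M0 * (n5 * p20 * p30 * n45)) * (p10 * p10 * p40 * p40 * p50 * p50 * n15 * p20 * n25 * p30 * n35)"
      by (simp only: K_def mult_ac)
    then show ?thesis unfolding M0 A_def power2_eq_square by (simp only: mult_ac)
  qed
  have 1: "M1 * K = A * B * (p50 * p30 * p20)"
  proof -
    have "M1 * K = (M1 * (p10 * p40)) * (p20 * p30 * p50 * n5 * p10 * n15 * p20 * n25 * p30 * n35 * p40 * n45 * p50)"
      by (simp only: K_def mult_ac)
    then show ?thesis unfolding M1 A_def B_def by (simp only: mult_ac)
  qed
  have 2: "M2a * K = A ^ 2 * (p50 * p40 * p10)"
  proof -
    have "M2a * K = (M2a * (n5 * p20 * p20 * p30 * p30 * n45)) * (p10 * p40 * p50 * p10 * n15 * n25 * n35 * p40 * p50)"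
      by (simp only: K_def mult_ac)
    then show ?thesis unfolding M2a A_def power2_eq_square by (simp only: mult_ac)
  qed
  have 3: "M2b * K = B ^ 2 * (p50 * p30 * p20)"
  proof -
    have "M2b * K = (M2b * (p10 * p10 * n15 * n35 * p40 * p40)) * (p20 * p30 * p50 * n5 * p20 * n25 * p30 * n45 * p50)"
      by (simp only: K_def mult_ac)
    then show ?thesis unfolding M2b B_def power2_eq_square by (simp only: mult_ac)
  qed
  have 4: "M3 * K = A * B * (p50 * p40 * p10)"
  proof -
    have "M3 * K = (M3 * (p20 * p30)) * (p10 * p40 * p50 * n5 * p10 * n15 * p20 * n25 * p30 * n35 * p40 * n45 * p50)"
      by (simp only: K_def mult_ac)
    then show ?thesis unfolding M3 A_def B_def by (simp only: mult_ac)
  qed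
  have 5: "M4 * K = B ^ 2 * (p50 * p40 * p10)"
  proof -
    have "M4 * K = (M4 * (p10 * n15 * n35 * p40)) * (p20 * p30 * p50 * n5 * p10 * p20 * n25 * p30 * p40 * n45 * p50)"
      by (simp only: K_def mult_ac)
    then show ?thesis unfolding M4 B_def power2_eq_square by (simp only: mult_ac)
  qed
  have "(M0 + X * M1 + X ^ 2 * (c * M2a - M2b) + X ^ 3 * (c * M3) + X ^ 4 * (- c * M4)) * K
    = M0 * K + X * (M1 * K) + X ^ 2 * (c * (M2a * K) - M2b * K) + X ^ 3 * (c * (M3 * K)) - X ^ 4 * (c * (M4 * K))"
    by (simp add: algebra_simps)
  also have "\<dots> = (A ^ 2 + X * A * B - X ^ 2 * B ^ 2) * (p50 * p30 * p20 + c * (X ^ 2 * (p50 * p40 * p10)))"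
    unfolding 0 1 2 3 4 5 by (simp add: algebra_simps eval_nat_numeral)
  finally show ?thesis .
qed

theorem theorem2p12:
  fixes \<zeta> :: complex
  assumes "\<zeta> ^ 5 = 1" and "\<forall>k::nat. 0 < k \<and> k < 5 \<longrightarrow> \<zeta> ^ k \<noteq> 1"
  shows "Abs_fps (\<lambda>n. \<Sum>\<^sub>\<infinity>m::int. M2 m n * \<zeta> powi m)
       = fps_compose M2_05_0 (fps_X ^ 5)
         + fps_X * fps_compose M2_05_1 (fps_X ^ 5)
         + fps_X ^ 2 * fps_compose (M2_05_2 \<zeta>) (fps_X ^ 5)
         + fps_X ^ 3 * fps_compose (M2_05_3 \<zeta>) (fps_X ^ 5)
         + fps_X ^ 4 * fps_compose (M2_05_4 \<zeta>) (fps_X ^ 5)"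
    (is "?L = ?R")
proof -
  have z1: "\<zeta> \<noteq> 1" and z2: "\<zeta> ^ 2 \<noteq> 1"
    using assms(2)[rule_format, of 1] assms(2)[rule_format, of 2] by auto
  have z0: "\<zeta> \<noteq> 0" using assms(1) by auto
  have zsum: "1 + \<zeta> + \<zeta> ^ 2 + \<zeta> ^ 3 + \<zeta> ^ 4 = 0"
  proof -
    have "(1 - \<zeta>) * (1 + \<zeta> + \<zeta> ^ 2 + \<zeta> ^ 3 + \<zeta> ^ 4) = 1 - \<zeta> ^ 5"
      by (simp add: eval_nat_numeral algebra_simps)
    then show ?thesis using assms(1) z1 by simp
  qed
  have zinv: "inverse \<zeta> = \<zeta> ^ 4"
    by (rule inverse_unique) (use assms(1) in \<open>simp add: eval_nat_numeral\<close>)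
  \<comment> \<open>For w = \<zeta>^2 the coefficient w^2 + w^3 of the dissection is \<zeta> +
    \<zeta>^4, the constant of the claim.\<close>
  have zp: "(\<zeta> ^ 2) ^ 5 = 1" "(\<zeta> ^ 2) ^ 4 = \<zeta> ^ 3" "(\<zeta> ^ 2) ^ 2 + (\<zeta> ^ 2) ^ 3 = \<zeta> + \<zeta> ^ 4"
    using assms(1) by (simp_all add: eval_nat_numeral mult.assoc)

  \<comment> \<open>Modulus 50 is common to the products modulo 10 under q -> q^5 and the products
    modulo 25 under q -> q^2 or q -> -q.\<close>
  define p where "p = (\<lambda>j. qpinf (1 :: complex) j 50)"
  define n where "n = (\<lambda>j. qpinf (-1 :: complex) j 50)"
  define c where "c = fps_const (\<zeta> + \<zeta> ^ 4)"
  \<comment> \<open>The first bracket is E(q^10), the second E(-q^5).\<close>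
  define K where "K = (p 10 * p 20 * p 30 * p 40 * p 50)
    * (n 5 * p 10 * n 15 * p 20 * n 25 * p 30 * n 35 * p 40 * n 45 * p 50)"
  define A where "A = (n 25 * p 50) * (n 15 * p 40) * (p 10 * n 35)"
  define B where "B = (n 25 * p 50) * (p 20 * n 45) * (n 5 * p 30)"

  have X5: "(fps_X ^ 5 :: complex fps) $ 0 = 0" by simp
  have P10: "P10 1 j oo fps_X ^ 5 = p (5 * j)" "P10 (-1) j oo fps_X ^ 5 = n (5 * j)" for j
    by (simp_all add: p_def n_def qpinf_compose_X_power)
  note comp = fps_compose_mult_distrib[OF X5] P10
  have quot: "((f / g) oo fps_X ^ 5) * (g oo fps_X ^ 5) = f oo fps_X ^ 5" if "g $ 0 = 1" for f g :: "complex fps"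
    using that by (intro quotient_compose_mult) simp_all

  define M2a where "M2a = ((P10 1 2 * P10 (-1) 3 * P10 (-1) 5 * P10 (-1) 7 * P10 1 8 * P10 1 10)
        / (P10 (-1) 1 * P10 1 4 * P10 1 4 * P10 1 6 * P10 1 6 * P10 (-1) 9)) oo fps_X ^ 5"
  define M2b where "M2b = ((P10 (-1) 1 * P10 1 4 * P10 (-1) 5 * P10 1 6 * P10 (-1) 9 * P10 1 10)
        / (P10 1 2 * P10 1 2 * P10 (-1) 3 * P10 (-1) 7 * P10 1 8 * P10 1 8)) oo fps_X ^ 5"
  define M3 where "M3 = ((P10 (-1) 5 * P10 1 10) / (P10 1 4 * P10 1 6)) oo fps_X ^ 5"
  define M4 where "M4 = ((P10 (-1) 1 * P10 (-1) 5 * P10 (-1) 9 * P10 1 10)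
      / (P10 1 2 * P10 (-1) 3 * P10 (-1) 7 * P10 1 8)) oo fps_X ^ 5"

  have "?R * K = (fps_compose M2_05_0 (fps_X ^ 5) + fps_X * fps_compose M2_05_1 (fps_X ^ 5)
      + fps_X ^ 2 * (c * M2a - M2b) + fps_X ^ 3 * (c * M3) + fps_X ^ 4 * (- c * M4)) * K"
    by (simp add: M2_05_2_def M2_05_3_def M2_05_4_def c_def M2a_def M2b_def M3_def M4_def
        fps_compose_sub_distrib fps_compose_mult_distrib[OF X5] fps_compose_uminus del: fps_const_add)
  also have "\<dots> = (A ^ 2 + fps_X * A * B - fps_X ^ 2 * B ^ 2)
      * (p 50 * p 30 * p 20 + c * (fps_X ^ 2 * (p 50 * p 40 * p 10)))"
    unfolding A_def B_def K_def
  proof (rule five_dissection_identity)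
    show "fps_compose M2_05_0 (fps_X ^ 5) * (n 5 * p 20 * p 30 * n 45) = n 15 * n 25 * n 35 * p 50"
      using quot[of "P10 (-1) 1 * P10 1 4 * P10 1 6 * P10 (-1) 9"]
      by (simp add: M2_05_0_def qpinf_nth_0 comp)
    show "fps_compose M2_05_1 (fps_X ^ 5) * (p 10 * p 40) = n 25 * p 50"
      using quot[of "P10 1 2 * P10 1 8"] by (simp add: M2_05_1_def qpinf_nth_0 comp)
    show "M2a * (n 5 * p 20 * p 20 * p 30 * p 30 * n 45) = p 10 * n 15 * n 25 * n 35 * p 40 * p 50"
      using quot[of "P10 (-1) 1 * P10 1 4 * P10 1 4 * P10 1 6 * P10 1 6 * P10 (-1) 9"]
      by (simp add: M2a_def qpinf_nth_0 comp)
    show "M2b * (p 10 * p 10 * n 15 * n 35 * p 40 * p 40) = n 5 * p 20 * n 25 * p 30 * n 45 * p 50"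
      using quot[of "P10 1 2 * P10 1 2 * P10 (-1) 3 * P10 (-1) 7 * P10 1 8 * P10 1 8"]
      by (simp add: M2b_def qpinf_nth_0 comp)
    show "M3 * (p 20 * p 30) = n 25 * p 50"
      using quot[of "P10 1 4 * P10 1 6"] by (simp add: M3_def qpinf_nth_0 comp)
    show "M4 * (p 10 * n 15 * n 35 * p 40) = n 5 * n 25 * n 45 * p 50"
      using quot[of "P10 1 2 * P10 (-1) 3 * P10 (-1) 7 * P10 1 8"]
      by (simp add: M4_def qpinf_nth_0 comp)
  qed
  finally have R: "?R * K = (A ^ 2 + fps_X * A * B - fps_X ^ 2 * B ^ 2)
      * (p 50 * p 30 * p 20 + c * (fps_X ^ 2 * (p 50 * p 40 * p 10)))" .

  have X2: "(fps_X ^ 2 :: complex fps) $ 0 = 0" by simp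
  \<comment> \<open>\<zeta>^2 and \<zeta>^3 are the nontrivial roots missing from the denominator
    \<zeta>, \<zeta>^4 of the generating function; T completes that denominator to E(q^10).\<close>
  define T where "T = qpinf 1 2 2 * qpinf (\<zeta> ^ 2) 2 2 * qpinf (\<zeta> ^ 3) 2 2"
  have T: "T = p 50 * p 30 * p 20 + c * (fps_X ^ 2 * (p 50 * p 40 * p 10))"
    using arg_cong[OF triple_product_root_dissection[OF zp(1) z2], of "\<lambda>f. f oo fps_X ^ 2"]
    unfolding zp(2,3)
    by (simp add: T_def p_def c_def fps_compose_add_distrib fps_compose_mult_distrib[OF X2]
        qpinf_compose_X_power del: fps_const_add)
  have "qpinf 1 2 2 * qpinf \<zeta> 2 2 * qpinf (\<zeta> ^ 2) 2 2 * qpinf (\<zeta> ^ 3) 2 2 * qpinf (\<zeta> ^ 4) 2 2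
      = qpinf 1 10 10"
    using arg_cong[OF qpinf_fifth_roots[OF assms(1) zsum], of "\<lambda>f. f oo fps_X ^ 2"]
    by (simp add: fps_compose_mult_distrib[OF X2] qpinf_compose_X_power)
  also have "\<dots> = p 10 * p 20 * p 30 * p 40 * p 50"
    using qpinf_split_5[of 10 "1::complex" 10] by (simp add: p_def)
  finally have D: "qpinf \<zeta> 2 2 * qpinf (\<zeta> ^ 4) 2 2 * T = p 10 * p 20 * p 30 * p 40 * p 50"
    by (simp add: T_def mult_ac)

  define E where "E = qpinf (-1) 1 2 * qpinf (1::complex) 2 2"
  have mX: "(- fps_X :: complex fps) $ 0 = 0" by simp
  \<comment> \<open>This is \<open>euler_dissection\<close> under q -> -q; only the middle term,
    which carries an odd power of q, changes its explicit sign.\<close>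
  have E: "E * (n 5 * p 10 * n 15 * p 20 * n 25 * p 30 * n 35 * p 40 * n 45 * p 50)
    = A ^ 2 + fps_X * A * B - fps_X ^ 2 * B ^ 2"
  proof -
    let ?neg = "\<lambda>f. f oo (- fps_X) :: complex fps"
    have 1: "?neg (qpinf 1 1 1) = E"
      using qpinf_split_double[of 1 "1::complex" 1]
      by (simp add: E_def fps_compose_mult_distrib[OF mX] qpinf_compose_uminus_X numeral_2_eq_2)
    have 25: "?neg (qpinf 1 j 25) = qpinf ((-1) ^ j) j 50 * qpinf ((-1) ^ (j + 25)) (j + 25) 50" for j
      using qpinf_split_double[of 25 "1::complex" j]
      by (simp add: fps_compose_mult_distrib[OF mX] qpinf_compose_uminus_X)
    have 5: "?neg (qpinf 1 5 5) = n 5 * p 10 * n 15 * p 20 * n 25 * p 30 * n 35 * p 40 * n 45 * p 50"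
      using qpinf_split_5[of 5 "1::complex" 5]
      by (simp add: fps_compose_mult_distrib[OF mX] 25 p_def n_def mult_ac)
    have "E * ?neg (qpinf 1 5 5) = A ^ 2 + fps_X * A * B - fps_X ^ 2 * B ^ 2"
      unfolding 1[symmetric] fps_compose_mult_distrib[OF mX, symmetric]
        euler_dissection[OF assms(1) zsum]
      by (simp add: fps_compose_sub_distrib fps_compose_mult_distrib[OF mX] fps_compose_power[OF mX]
          power2_eq_square 25 A_def B_def p_def n_def)
    then show ?thesis unfolding 5 .
  qed

  have "?L * K = ?L * (qpinf \<zeta> 2 2 * qpinf (inverse \<zeta>) 2 2) * T
      * (n 5 * p 10 * n 15 * p 20 * n 25 * p 30 * n 35 * p 40 * n 45 * p 50)"
    unfolding K_def D[symmetric] zinv by (simp only: mult_ac)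
  also have "\<dots> = (E * (n 5 * p 10 * n 15 * p 20 * n 25 * p 30 * n 35 * p 40 * n 45 * p 50)) * T"
    unfolding M2_gen_ev[OF z0] E_def by (simp only: mult_ac)
  also have "\<dots> = ?R * K"
    unfolding E R T ..
  finally have "?L * K = ?R * K" .
  moreover have "K $ 0 = 1"
    by (simp add: K_def p_def n_def qpinf_nth_0)
  then have "K \<noteq> 0" by auto
  ultimately show ?thesis by simp
qed

end
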